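(* Let $T\in\mathbb{N}$ and $t_0\in\{0,\dots,T-1\}$, let $X\subset\mathbb{R}^n$, $U\subset\mathbb{R}^m$, $f:\mathbb{R}^n\times\mathbb{R}^m\times\mathbb{N}\to\mathbb{R}^n$, $c_t:\mathbb{R}^n\times\mathbb{R}^m\to\mathbb{R}$ for $t=t_0,\dots,T-1$, $c_T:\mathbb{R}^n\to\mathbb{R}$, and $x_0\in X$. Suppose $F:X\times\{t_0,\dots,T\}\to\mathbb{R}$ satisfies, for all $x\in X$, $$F(x,t)=\inf_{u\in\Gamma_{t,x}}\{c_t(x,u)+F(f(x,u,t),t+1)\}\quad\text{for all }t\in\{t_0,\dots,T-1\},\qquad F(x,T)=c_T(x).$$ Then $$\pi^*(x,t)=\arg\inf_{u\in\Gamma_{t,x}}\{c_t(x,u)+F(f(x,u,t),t+1)\}$$ (that is, any map $\pi^*$ with $\pi^*(x,t)\in\Gamma_{t,x}$ attaining this infimum for every $x\in X$ and $t\in\{t_0,\dots,T-1\}$) is an optimal policy for the problem $P(t_0,x_0)$ defined in the context.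
   Context: $P(t_0,x_0)$ is the problem of minimizing $$J_{t_0,x_0}(\mathbf{u},\mathbf{x})=\sum_{k=t_0}^{T-1}c_k(x(k),u(k))+c_T(x(T))$$ over $\mathbf{u}=(u(t_0),\dots,u(T-1))$ and $\mathbf{x}=(x(t_0),\dots,x(T))$ subject to $x(t_0)=x_0$; $x(k+1)=f[x(k),u(k),k]$ for $k=t_0,\dots,T-1$; $x(k)\in X$ for $k=t_0+1,\dots,T$; $u(k)\in U$ for $k=t_0,\dots,T-1$. A pair solves $P(t_0,x_0)$ if it is feasible and attains the minimum of $J_{t_0,x_0}$ over feasible pairs. For $x\in X$, $\Gamma_{t,x}=\{u\in U: f[x,u,t]\in X\}$; standing assumption: $\Gamma_{t,x}$ is nonempty for all $x\in X$ and all $t$. A policy is a map $(x,t)\mapsto\pi(x,t)\in\Gamma_{t,x}$. A policy $\pi^*$ is optimal for $P(t_0,x_0)$ if the sequences defined by $x^*(t_0)=x_0$, $u^*(t)=\pi^*(x^*(t),t)$, $x^*(t+1)=f[x^*(t),u^*(t),t]$ for $t=t_0,\dots,T-1$ solve $P(t_0,x_0)$. *)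

theory Defs
  imports "HOL-Analysis.Analysis" "HOL-Library.Extended_Real"
begin

text \<open>
  The finite-horizon problem P(t0, x0) with terminal time T.  Controls \<open>u\<close> and states \<open>x\<close> are
  functions on all of \<open>nat\<close>, but only the values \<open>u k\<close> for \<open>t0 \<le> k < T\<close> and \<open>x k\<close> for
  \<open>t0 \<le> k \<le> T\<close> enter the definitions below.
\<close>

definition total_cost ::
  "nat \<Rightarrow> (nat \<Rightarrow> real^'n \<Rightarrow> real^'m \<Rightarrow> real) \<Rightarrow> (real^'n \<Rightarrow> real) \<Rightarrow> nat \<Rightarrow>
    (nat \<Rightarrow> real^'m) \<Rightarrow> (nat \<Rightarrow> real^'n) \<Rightarrow> real" where
  "total_cost T c cT t0 u x = (\<Sum>k=t0..<T. c k (x k) (u k)) + cT (x T)"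

definition feasible_pair ::
  "nat \<Rightarrow> (real^'n) set \<Rightarrow> (real^'m) set \<Rightarrow> (real^'n \<Rightarrow> real^'m \<Rightarrow> nat \<Rightarrow> real^'n) \<Rightarrow>
    nat \<Rightarrow> real^'n \<Rightarrow> (nat \<Rightarrow> real^'m) \<Rightarrow> (nat \<Rightarrow> real^'n) \<Rightarrow> bool" where
  "feasible_pair T X U f t0 x0 u x \<longleftrightarrow>
     x t0 = x0 \<and>
     (\<forall>k\<in>{t0..<T}. x (k + 1) = f (x k) (u k) k) \<and>
     (\<forall>k\<in>{t0+1..T}. x k \<in> X) \<and>
     (\<forall>k\<in>{t0..<T}. u k \<in> U)"

definition solves_problem ::
  "nat \<Rightarrow> (real^'n) set \<Rightarrow> (real^'m) set \<Rightarrow> (real^'n \<Rightarrow> real^'m \<Rightarrow> nat \<Rightarrow> real^'n) \<Rightarrow>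
    (nat \<Rightarrow> real^'n \<Rightarrow> real^'m \<Rightarrow> real) \<Rightarrow> (real^'n \<Rightarrow> real) \<Rightarrow>
    nat \<Rightarrow> real^'n \<Rightarrow> (nat \<Rightarrow> real^'m) \<Rightarrow> (nat \<Rightarrow> real^'n) \<Rightarrow> bool" where
  "solves_problem T X U f c cT t0 x0 u x \<longleftrightarrow>
     feasible_pair T X U f t0 x0 u x \<and>
     (\<forall>u' x'. feasible_pair T X U f t0 x0 u' x' \<longrightarrow>
        total_cost T c cT t0 u x \<le> total_cost T c cT t0 u' x')"

definition admissible_controls ::
  "(real^'n) set \<Rightarrow> (real^'m) set \<Rightarrow> (real^'n \<Rightarrow> real^'m \<Rightarrow> nat \<Rightarrow> real^'n) \<Rightarrow>
    nat \<Rightarrow> real^'n \<Rightarrow> (real^'m) set" where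
  "admissible_controls X U f t x = {u \<in> U. f x u t \<in> X}"

text \<open>A policy is a map on \<open>X \<times> {t0..<T}\<close>; its values elsewhere are irrelevant.\<close>

definition is_policy ::
  "nat \<Rightarrow> (real^'n) set \<Rightarrow> (real^'m) set \<Rightarrow> (real^'n \<Rightarrow> real^'m \<Rightarrow> nat \<Rightarrow> real^'n) \<Rightarrow>
    nat \<Rightarrow> (real^'n \<Rightarrow> nat \<Rightarrow> real^'m) \<Rightarrow> bool" where
  "is_policy T X U f t0 \<pi> \<longleftrightarrow>
     (\<forall>x\<in>X. \<forall>t\<in>{t0..<T}. \<pi> x t \<in> admissible_controls X U f t x)"

text \<open>
  The state sequence generated by a policy from \<open>x0\<close> at time \<open>t0\<close>, indexed by absolute time.
  The (irrelevant) values before \<open>t0\<close> are set to \<open>x0\<close>, so that the value at \<open>t0\<close> is \<open>x0\<close>.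
\<close>

primrec policy_state ::
  "(real^'n \<Rightarrow> real^'m \<Rightarrow> nat \<Rightarrow> real^'n) \<Rightarrow> (real^'n \<Rightarrow> nat \<Rightarrow> real^'m) \<Rightarrow>
    nat \<Rightarrow> real^'n \<Rightarrow> nat \<Rightarrow> real^'n" where
  "policy_state f \<pi> t0 x0 0 = x0"
| "policy_state f \<pi> t0 x0 (Suc t) =
     (if t < t0 then x0
      else f (policy_state f \<pi> t0 x0 t) (\<pi> (policy_state f \<pi> t0 x0 t) t) t)"

definition policy_control ::
  "(real^'n \<Rightarrow> real^'m \<Rightarrow> nat \<Rightarrow> real^'n) \<Rightarrow> (real^'n \<Rightarrow> nat \<Rightarrow> real^'m) \<Rightarrow>
    nat \<Rightarrow> real^'n \<Rightarrow> nat \<Rightarrow> real^'m" where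
  "policy_control f \<pi> t0 x0 t = \<pi> (policy_state f \<pi> t0 x0 t) t"

lemma policy_state_start: "policy_state f \<pi> t0 x0 t0 = x0"
  by (cases t0) auto

lemma policy_state_step:
  "t0 \<le> t \<Longrightarrow> policy_state f \<pi> t0 x0 (t + 1) =
     f (policy_state f \<pi> t0 x0 t) (policy_control f \<pi> t0 x0 t) t"
  by (simp add: policy_control_def)

definition optimal_policy ::
  "nat \<Rightarrow> (real^'n) set \<Rightarrow> (real^'m) set \<Rightarrow> (real^'n \<Rightarrow> real^'m \<Rightarrow> nat \<Rightarrow> real^'n) \<Rightarrow>
    (nat \<Rightarrow> real^'n \<Rightarrow> real^'m \<Rightarrow> real) \<Rightarrow> (real^'n \<Rightarrow> real) \<Rightarrow>
    nat \<Rightarrow> real^'n \<Rightarrow> (real^'n \<Rightarrow> nat \<Rightarrow> real^'m) \<Rightarrow> bool" where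
  "optimal_policy T X U f c cT t0 x0 \<pi> \<longleftrightarrow>
     is_policy T X U f t0 \<pi> \<and>
     solves_problem T X U f c cT t0 x0 (policy_control f \<pi> t0 x0) (policy_state f \<pi> t0 x0)"

text \<open>
  The infimum \<open>inf {c t x u + F (f x u t) (t + 1) | u admissible}\<close> is taken in \<open>ereal\<close>: the real
  \<open>Inf\<close> is unspecified on sets that are not bounded below, whereas here it is \<open>-\<infinity>\<close> and thus
  differs from every real value.
\<close>

definition bellman_inf ::
  "(real^'n) set \<Rightarrow> (real^'m) set \<Rightarrow> (real^'n \<Rightarrow> real^'m \<Rightarrow> nat \<Rightarrow> real^'n) \<Rightarrow>
    (nat \<Rightarrow> real^'n \<Rightarrow> real^'m \<Rightarrow> real) \<Rightarrow> (real^'n \<Rightarrow> nat \<Rightarrow> real) \<Rightarrow>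
    real^'n \<Rightarrow> nat \<Rightarrow> ereal" where
  "bellman_inf X U f c F x t =
     (INF u\<in>admissible_controls X U f t x. ereal (c t x u + F (f x u t) (t + 1)))"

end

theory Submission
  imports Defs
begin

text \<open>
  Think of \<open>F\<close> as a potential.  Along any trajectory the terms \<open>F (x (k + 1)) (k + 1) - F (x k) k\<close>
  telescope, so adding them to the stage costs rewrites the total cost as the initial potential
  \<open>F x0 t0\<close> plus a sum of one-step losses \<open>c k (x k) (u k) + F (x (k + 1)) (k + 1) - F (x k) k\<close>
  (lemma \<open>total_cost_eq_value_plus_losses\<close>).  Here the terminal condition \<open>F x T = cT x\<close> is what
  cancels the terminal cost.  The Bellman equation makes \<open>F x k\<close> a lower bound of
  \<open>c k x u + F (f x u k) (k + 1)\<close> over admissible \<open>u\<close>, so every loss of a feasible pair is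
  nonnegative and \<open>F x0 t0\<close> bounds all costs from below; a policy that attains the infimum has only
  zero losses, so its cost is exactly \<open>F x0 t0\<close>.
\<close>

text \<open>
  The state constraint is imposed only after \<open>t0\<close>; at \<open>t0\<close> itself membership comes from the
  initial state, which is why the initial state has to lie in \<open>X\<close> for the Bellman equation to be
  usable at the first step.
\<close>

lemma feasible_pair_state_in:
  assumes "feasible_pair T X U f t0 x0 u x" "x0 \<in> X" "k \<in> {t0..T}"
  shows "x k \<in> X"
  using assms by (cases "k = t0") (auto simp: feasible_pair_def)

lemma feasible_pair_control_admissible:
  assumes "feasible_pair T X U f t0 x0 u x" "k \<in> {t0..<T}"
  shows "u k \<in> admissible_controls X U f k (x k)"
proof -
  have "k + 1 \<in> {t0+1..T}"
    using assms(2) by simp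
  then have "x (k + 1) \<in> X" "x (k + 1) = f (x k) (u k) k" "u k \<in> U"
    using assms unfolding feasible_pair_def by blast+
  then show ?thesis
    by (simp add: admissible_controls_def)
qed

lemma feasible_pair_policy:
  assumes "x0 \<in> X" and "is_policy T X U f t0 \<pi>"
  shows "feasible_pair T X U f t0 x0 (policy_control f \<pi> t0 x0) (policy_state f \<pi> t0 x0)"
proof -
  let ?x = "policy_state f \<pi> t0 x0" and ?u = "policy_control f \<pi> t0 x0"
  have one_step: "?u k \<in> U \<and> ?x (k + 1) \<in> X" if "?x k \<in> X" "k \<in> {t0..<T}" for k
    using assms(2) that
    by (auto simp: is_policy_def admissible_controls_def policy_control_def)
  have mem: "k \<le> T \<longrightarrow> ?x k \<in> X" if "t0 \<le> k" for k
    using that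
  proof (induction k rule: dec_induct)
    case base
    show ?case
      using assms(1) by (simp add: policy_state_start)
  next
    case (step k)
    then show ?case
      using one_step[of k] by auto
  qed
  show ?thesis
    using mem one_step by (auto simp: feasible_pair_def policy_state_start policy_control_def)
qed

text \<open>
  Each summand on the right is the excess of using \<open>u k\<close> at time \<open>k\<close> and paying \<open>F\<close> afterwards
  over paying \<open>F\<close> at once.  The identity turns comparing total costs into comparing these
  excesses step by step.
\<close>

lemma total_cost_eq_value_plus_losses:
  assumes "t0 \<le> T" and "F (x T) T = cT (x T)"
  shows "total_cost T c cT t0 u x =
    F (x t0) t0 + (\<Sum>k=t0..<T. c k (x k) (u k) + F (x (k + 1)) (k + 1) - F (x k) k)"
proof -
  have "(\<Sum>k=t0..<T. F (x (k + 1)) (k + 1) - F (x k) k) = F (x T) T - F (x t0) t0"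
    using sum_Suc_diff'[OF assms(1), of "\<lambda>k. F (x k) k"] by simp
  moreover have "(\<Sum>k=t0..<T. c k (x k) (u k) + F (x (k + 1)) (k + 1) - F (x k) k) =
      (\<Sum>k=t0..<T. c k (x k) (u k)) + (\<Sum>k=t0..<T. F (x (k + 1)) (k + 1) - F (x k) k)"
    by (simp add: sum.distrib[symmetric] add_diff_eq)
  ultimately show ?thesis
    using assms(2) by (simp add: total_cost_def)
qed

lemma bellman_inf_le:
  assumes "ereal (F x t) = bellman_inf X U f c F x t"
    and "u \<in> admissible_controls X U f t x"
  shows "F x t \<le> c t x u + F (f x u t) (t + 1)"
proof -
  have "ereal (F x t) \<le> ereal (c t x u + F (f x u t) (t + 1))"
    unfolding assms(1) bellman_inf_def using assms(2) by (rule INF_lower)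
  then show ?thesis
    by simp
qed

text \<open>
  Verification bound: every step of a feasible pair uses an admissible control at a state of \<open>X\<close>, so
  none of the losses in the telescoped cost is negative.
\<close>

lemma value_le_total_cost:
  assumes "t0 \<le> T" and "x0 \<in> X"
    and bellman: "\<forall>x\<in>X. \<forall>t\<in>{t0..<T}. ereal (F x t) = bellman_inf X U f c F x t"
    and terminal: "\<forall>x\<in>X. F x T = cT x"
    and feas: "feasible_pair T X U f t0 x0 u x"
  shows "F x0 t0 \<le> total_cost T c cT t0 u x"
proof -
  have mem: "x k \<in> X" if "k \<in> {t0..T}" for k
    using feasible_pair_state_in[OF feas \<open>x0 \<in> X\<close> that] .
  have "0 \<le> c k (x k) (u k) + F (x (k + 1)) (k + 1) - F (x k) k" if "k \<in> {t0..<T}" for k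
  proof -
    have "ereal (F (x k) k) = bellman_inf X U f c F (x k) k"
      using bellman mem[of k] that by auto
    from bellman_inf_le[where u = "u k", OF this] feasible_pair_control_admissible[OF feas that]
    have "F (x k) k \<le> c k (x k) (u k) + F (f (x k) (u k) k) (k + 1)"
      by simp
    moreover have "x (k + 1) = f (x k) (u k) k"
      using feas that by (auto simp: feasible_pair_def)
    ultimately show ?thesis
      by simp
  qed
  then have "0 \<le> (\<Sum>k=t0..<T. c k (x k) (u k) + F (x (k + 1)) (k + 1) - F (x k) k)"
    by (rule sum_nonneg)
  moreover have "F (x T) T = cT (x T)"
    using terminal mem[of T] \<open>t0 \<le> T\<close> by simp
  moreover have "x t0 = x0"
    using feas by (simp add: feasible_pair_def)
  ultimately show ?thesis
    using total_cost_eq_value_plus_losses[of t0 T F x cT c u] \<open>t0 \<le> T\<close> by simp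
qed

theorem corollary1:
  fixes T t0 :: nat
    and X :: "(real^'n) set"
    and U :: "(real^'m) set"
    and f :: "real^'n \<Rightarrow> real^'m \<Rightarrow> nat \<Rightarrow> real^'n"
    and c :: "nat \<Rightarrow> real^'n \<Rightarrow> real^'m \<Rightarrow> real"
    and cT :: "real^'n \<Rightarrow> real"
    and x0 :: "real^'n"
    and F :: "real^'n \<Rightarrow> nat \<Rightarrow> real"
    and \<pi> :: "real^'n \<Rightarrow> nat \<Rightarrow> real^'m"
  assumes "t0 < T"
    and "x0 \<in> X"
    and "\<forall>x\<in>X. \<forall>t\<in>{t0..<T}. admissible_controls X U f t x \<noteq> {}"
    and "\<forall>x\<in>X. \<forall>t\<in>{t0..<T}. ereal (F x t) = bellman_inf X U f c F x t"
    and "\<forall>x\<in>X. F x T = cT x"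
    and "\<forall>x\<in>X. \<forall>t\<in>{t0..<T}. \<pi> x t \<in> admissible_controls X U f t x \<and>
           ereal (c t x (\<pi> x t) + F (f x (\<pi> x t) t) (t + 1)) = bellman_inf X U f c F x t"
  shows "optimal_policy T X U f c cT t0 x0 \<pi>"
proof -
  let ?x = "policy_state f \<pi> t0 x0" and ?u = "policy_control f \<pi> t0 x0"
  have policy: "is_policy T X U f t0 \<pi>"
    using assms(6) by (simp add: is_policy_def)
  have feas: "feasible_pair T X U f t0 x0 ?u ?x"
    using feasible_pair_policy[OF assms(2) policy] .
  have mem: "?x k \<in> X" if "k \<in> {t0..T}" for k
    using feasible_pair_state_in[OF feas assms(2) that] .
  have no_loss: "c k (?x k) (?u k) + F (?x (k + 1)) (k + 1) - F (?x k) k = 0"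
    if k: "k \<in> {t0..<T}" for k
  proof -
    have xk: "?x k \<in> X"
      using mem[of k] k by simp
    have "ereal (c k (?x k) (?u k) + F (f (?x k) (?u k) k) (k + 1)) = ereal (F (?x k) k)"
      using assms(4,6) xk k by (simp add: policy_control_def)
    then have "c k (?x k) (?u k) + F (f (?x k) (?u k) k) (k + 1) = F (?x k) k"
      by (simp only: ereal.inject)
    moreover have "?x (k + 1) = f (?x k) (?u k) k"
      using policy_state_step k by auto
    ultimately show ?thesis
      by simp
  qed
  have "F (?x T) T = cT (?x T)"
    using assms(5) mem[of T] assms(1) by simp
  then have "total_cost T c cT t0 ?u ?x = F x0 t0 +
      (\<Sum>k=t0..<T. c k (?x k) (?u k) + F (?x (k + 1)) (k + 1) - F (?x k) k)"
    using total_cost_eq_value_plus_losses[of t0 T F ?x cT c ?u] assms(1)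
    by (simp only: policy_state_start less_imp_le)
  also have "\<dots> = F x0 t0"
    by (subst sum.neutral) (use no_loss in blast, simp)
  finally have cost: "total_cost T c cT t0 ?u ?x = F x0 t0" .
  show ?thesis
    unfolding optimal_policy_def solves_problem_def cost
    using policy feas
      value_le_total_cost[OF less_imp_le[OF assms(1)] assms(2) assms(4) assms(5)]
    by blast
qed

end
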